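(* Let $J\subset(0,1)^{2}$ and $H\subset\mathbb{R}$ be compact. As $N\to\infty$, uniformly for integers $K,n$ with $(\kappa,\eta)=(K/N,n/N)\in J$ and for $t\in H$ with $k:=\mu+t\in\mathbb{Z}$, one has the complete asymptotic expansion $$\log\Bigl[\sqrt{2\pi\,\frac{k\,(K-k)\,(n-k)\,(L+k)\,N}{K(N-K)\,n\,(N-n)}}\;P(k)\Bigr]\sim\sum_{m\ge1}\frac{\widehat A_m(t)}{N^{m}},$$ with $$\widehat A_m(t)=\frac{(-1)^{m+1}}{m(m+1)}\Bigl[(W_m-1)\,B_{m+1}-\widehat\Xi_m\,\widehat B_{m+1}(t)\Bigr],\qquad \widehat\Xi_m=(a^{-m}+d^{-m})+(-1)^{m+1}(b^{-m}+c^{-m}),$$ where $W_m=\kappa^{-m}+(1-\kappa)^{-m}+\eta^{-m}+(1-\eta)^{-m}$.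
   Context: The hypergeometric law $\mathrm{Hyp}(N,K,n)$ has mass function $P(k)=\binom Kk\binom{N-K}{n-k}\big/\binom Nn$, with mean $\mu=nK/N$. Here $N,K,n$ are integers with $0<K<N$, $0<n<N$; $\kappa=K/N$, $\eta=n/N$, $L=N-K-n$. Put $$a=\kappa\eta,\quad b=\kappa(1-\eta),\quad c=\eta(1-\kappa),\quad d=(1-\kappa)(1-\eta).$$ $B_n(t)$ denotes the Bernoulli polynomials, $\sum_{n\ge0}B_n(t)z^n/n!=ze^{tz}/(e^z-1)$, and $B_n=B_n(0)$. The reciprocal Bernoulli polynomials are $$\widehat B_n(t)=\tfrac12\bigl[B_n(t)+B_n(t+1)\bigr]=B_n(t)+\tfrac n2\,t^{n-1}\qquad(n\ge1).$$ Meaning of the expansion: for every fixed integer $M\ge0$, the difference between the left-hand side and $\sum_{m=1}^{M}\widehat A_m(t)N^{-m}$ is $O(N^{-M-1})$ as $N\to\infty$, with implied constant and threshold on $N$ depending only on $M$, $J$, $H$ (for $N$ large, $k$, $K-k$, $n-k$, $L+k$ are all positive, so the logarithm is defined). *)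

theory Defs
  imports "HOL-Analysis.Analysis" "HOL-Computational_Algebra.Computational_Algebra"
begin

text \<open>
  Bernoulli polynomials through their exponential generating function
  \<open>z e^(t z) / (e^z - 1)\<close>, read as a formal power series.  Both numerator and denominator
  have a simple zero at \<open>z = 0\<close>, so the division of formal power series is exact; see
  \<open>bernoulli_gf_mult\<close> below.
\<close>

definition bernoulli_gf :: "real \<Rightarrow> real fps" where
  "bernoulli_gf t = fps_X * fps_exp t / (fps_exp 1 - 1)"

definition bernoulli_poly :: "nat \<Rightarrow> real \<Rightarrow> real" where
  "bernoulli_poly n t = fact n * fps_nth (bernoulli_gf t) n"

definition bernoulli_number :: "nat \<Rightarrow> real" where
  "bernoulli_number n = bernoulli_poly n 0"

definition reciprocal_bernoulli_poly :: "nat \<Rightarrow> real \<Rightarrow> real" where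
  "reciprocal_bernoulli_poly n t = (bernoulli_poly n t + bernoulli_poly n (t + 1)) / 2"

lemma fps_exp_1_minus_1_nonzero: "fps_exp 1 - 1 \<noteq> (0 :: real fps)"
proof
  assume "fps_exp 1 - 1 = (0 :: real fps)"
  hence "fps_nth (fps_exp 1 - 1 :: real fps) 1 = 0" by simp
  thus False by simp
qed

lemma bernoulli_gf_mult: "bernoulli_gf t * (fps_exp 1 - 1) = fps_X * fps_exp t"
proof -
  have s1: "subdegree (fps_exp 1 - 1 :: real fps) = 1"
    by (rule subdegreeI) auto
  have s2: "subdegree (fps_X * fps_exp t) = 1"
    by (rule subdegreeI) (auto simp: fps_X_mult_nth)
  have "(fps_exp 1 - 1) dvd fps_X * fps_exp t"
    using fps_exp_1_minus_1_nonzero s1 s2 by (subst fps_dvd_iff) auto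
  thus ?thesis unfolding bernoulli_gf_def by simp
qed

lemma bernoulli_poly_diff:
  "bernoulli_poly n (t + 1) - bernoulli_poly n t = real n * t ^ (n - 1)"
proof -
  have "(bernoulli_gf (t + 1) - bernoulli_gf t) * (fps_exp 1 - 1) =
        (fps_X * fps_exp t) * (fps_exp 1 - 1)"
    unfolding left_diff_distrib bernoulli_gf_mult
    by (simp add: fps_exp_add_mult algebra_simps)
  with fps_exp_1_minus_1_nonzero have *: "bernoulli_gf (t + 1) - bernoulli_gf t = fps_X * fps_exp t" by simp
  have "bernoulli_poly n (t + 1) - bernoulli_poly n t =
        fact n * fps_nth (bernoulli_gf (t + 1) - bernoulli_gf t) n"
    by (simp add: bernoulli_poly_def algebra_simps)
  also have "\<dots> = real n * t ^ (n - 1)"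
    unfolding * by (cases n) (simp_all add: fps_X_mult_nth field_simps)
  finally show ?thesis .
qed

lemma reciprocal_bernoulli_poly_altdef:
  "reciprocal_bernoulli_poly n t = bernoulli_poly n t + real n / 2 * t ^ (n - 1)"
  using bernoulli_poly_diff[of n t] by (simp add: reciprocal_bernoulli_poly_def field_simps)

text \<open>
  The mass function is defined at every integer \<open>k\<close>, with the convention that binomial
  coefficients with a negative lower index vanish.  For \<open>k > K\<close> or \<open>n - k > N - K\<close> the value
  is \<open>0\<close> by the definition of \<open>choose\<close>.  The natural number subtraction \<open>N - K\<close> presupposes
  \<open>K \<le> N\<close>.
\<close>

definition hypergeometric_mass :: "nat \<Rightarrow> nat \<Rightarrow> nat \<Rightarrow> int \<Rightarrow> real" where
  "hypergeometric_mass N K n k =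
     (if 0 \<le> k \<and> k \<le> int n
      then real (K choose nat k) * real ((N - K) choose nat (int n - k)) / real (N choose n)
      else 0)"

text \<open>In what follows \<open>\<kappa> = K / N\<close> and \<open>\<eta> = n / N\<close>.\<close>

definition coeff_W :: "real \<Rightarrow> real \<Rightarrow> nat \<Rightarrow> real" where
  "coeff_W \<kappa> \<eta> m = 1 / \<kappa> ^ m + 1 / (1 - \<kappa>) ^ m + 1 / \<eta> ^ m + 1 / (1 - \<eta>) ^ m"

definition coeff_Xi :: "real \<Rightarrow> real \<Rightarrow> nat \<Rightarrow> real" where
  "coeff_Xi \<kappa> \<eta> m =
     (let a = \<kappa> * \<eta>; b = \<kappa> * (1 - \<eta>); c = \<eta> * (1 - \<kappa>); d = (1 - \<kappa>) * (1 - \<eta>)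
      in (1 / a ^ m + 1 / d ^ m) + (-1) ^ (m + 1) * (1 / b ^ m + 1 / c ^ m))"

definition coeff_A :: "real \<Rightarrow> real \<Rightarrow> nat \<Rightarrow> real \<Rightarrow> real" where
  "coeff_A \<kappa> \<eta> m t =
     (-1) ^ (m + 1) / (real m * (real m + 1)) *
     ((coeff_W \<kappa> \<eta> m - 1) * bernoulli_number (m + 1)
      - coeff_Xi \<kappa> \<eta> m * reciprocal_bernoulli_poly (m + 1) t)"

text \<open>
  The left-hand side of the expansion; the factor \<open>N - K - n + k\<close> is \<open>L + k\<close> with
  \<open>L = N - K - n\<close> a possibly negative integer.
\<close>

definition log_normalized_mass :: "nat \<Rightarrow> nat \<Rightarrow> nat \<Rightarrow> int \<Rightarrow> real" where
  "log_normalized_mass N K n k =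
     (let L = int N - int K - int n
      in ln (sqrt (2 * pi *
               (real_of_int k * real_of_int (int K - k) * real_of_int (int n - k)
                  * real_of_int (L + k) * real N)
               / (real K * (real N - real K) * real n * (real N - real n)))
             * hypergeometric_mass N K n k))"

end

theory Submission
  imports Defs
begin

text \<open>
  The logarithm of the normalized mass is, exactly, a signed sum of nine terms
  \<open>g(y) = ln y! - ln y / 2 - ln (2\<pi>) / 2\<close>: the four margins \<open>K\<close>, \<open>N - K\<close>, \<open>n\<close>, \<open>N - n\<close> of a
  two-by-two table with sign \<open>+\<close>, the total \<open>N\<close> and the four cells with sign \<open>-\<close>
  (\<open>log_normalized_mass_eq_log_fact_core\<close>).  The cells are \<open>a N + t\<close>, \<open>b N - t\<close>, \<open>c N - t\<close>, \<open>d N + t\<close>, so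
  what is needed is an expansion of \<open>g(x + t)\<close> in powers of \<open>1/x\<close>, uniform for bounded \<open>t\<close>:
  \<open>g(x + t) \<sim> (x + t) ln x - x + (\<Sum>m. (-1) ^ (m + 1) R\<^sub>m\<^sub>+\<^sub>1(t) / (m (m + 1) x ^ m))\<close>, where \<open>R\<^sub>m\<close>
  denotes the reciprocal Bernoulli polynomials.  Given this, the elementary parts cancel, and the
  coefficients combine to \<open>coeff_A\<close> because \<open>R\<^sub>m\<^sub>+\<^sub>1(-t) = (-1) ^ (m + 1) R\<^sub>m\<^sub>+\<^sub>1(t)\<close>
  (\<open>stirling_sum_combination\<close>).

  The expansion rests on one observation about its right-hand side \<open>S\<^sub>M(x, t)\<close>, truncated at \<open>M\<close>:
  since \<open>R\<^sub>n' = n R\<^sub>n\<^sub>-\<^sub>1\<close>, its derivative along the lines \<open>x + t = const\<close> telescopes to a single term of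
  order \<open>x ^ -(M + 1)\<close>, so \<open>S\<^sub>M\<close> depends on \<open>x + t\<close> only, up to the admissible error
  (\<open>stirling_sum_shift\<close>).  This has two uses.  It reduces the expansion to \<open>t = 0\<close>.  And with \<open>t = 1\<close> it
  shows that \<open>S\<^sub>M(n, 0)\<close> almost satisfies the recurrence \<open>g(n + 1) - g(n) = ln n + ln (1 + 1/n) / 2\<close>
  (\<open>stirling_error_step\<close>), so that the error at \<open>t = 0\<close> is a convergent sum of small increments.  Its
  limit is \<open>0\<close> by the Wallis product (\<open>stirling_remainder_tendsto_0\<close>).  Steps of length one suffice here
  because all nine arguments of \<open>g\<close> are natural numbers.
\<close>

section \<open>Bernoulli and reciprocal Bernoulli polynomials\<close>

lemma bernoulli_gf_shift: "bernoulli_gf t = fps_exp t * bernoulli_gf 0"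
proof -
  have "bernoulli_gf t * (fps_exp 1 - 1) = (fps_exp t * bernoulli_gf 0) * (fps_exp 1 - 1)"
    by (simp add: bernoulli_gf_mult mult.assoc mult.commute)
  with fps_exp_1_minus_1_nonzero show ?thesis by simp
qed

lemma bernoulli_poly_has_derivative:
  "(bernoulli_poly (Suc n) has_field_derivative real (Suc n) * bernoulli_poly n t) (at t)"
proof -
  have expand: "bernoulli_poly m = (\<lambda>s. fact m * (\<Sum>i=0..m. s ^ i / fact i * bernoulli_gf 0 $ (m - i)))"
    for m
  proof
    fix s :: real
    show "bernoulli_poly m s = fact m * (\<Sum>i=0..m. s ^ i / fact i * bernoulli_gf 0 $ (m - i))"
      unfolding bernoulli_poly_def by (subst bernoulli_gf_shift) (simp add: fps_mult_nth)
  qed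
  have "((\<lambda>s. \<Sum>i=0..Suc n. s ^ i / fact i * bernoulli_gf 0 $ (Suc n - i)) has_field_derivative
          (\<Sum>i=0..Suc n. real i * t ^ (i - 1) / fact i * bernoulli_gf 0 $ (Suc n - i))) (at t)"
    by (intro DERIV_sum DERIV_cmult_right DERIV_cdivide) (use DERIV_pow in simp)
  also have "(\<Sum>i=0..Suc n. real i * t ^ (i - 1) / fact i * bernoulli_gf 0 $ (Suc n - i)) =
             (\<Sum>i=0..n. t ^ i / fact i * bernoulli_gf 0 $ (n - i))"
    by (subst sum.atLeast0_atMost_Suc_shift) (auto intro!: sum.cong simp: divide_simps)
  finally have D: "((\<lambda>s. \<Sum>i=0..Suc n. s ^ i / fact i * bernoulli_gf 0 $ (Suc n - i)) has_field_derivative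
          (\<Sum>i=0..n. t ^ i / fact i * bernoulli_gf 0 $ (n - i))) (at t)" .
  show ?thesis
    unfolding expand by (rule DERIV_cong[OF DERIV_cmult[OF D]]) (simp add: algebra_simps)
qed

lemma reciprocal_bernoulli_poly_has_derivative:
  "(reciprocal_bernoulli_poly (Suc n) has_field_derivative
      real (Suc n) * reciprocal_bernoulli_poly n t) (at t)"
proof -
  have "((\<lambda>s. bernoulli_poly (Suc n) (s + 1)) has_field_derivative
          real (Suc n) * bernoulli_poly n (t + 1)) (at t)"
    using DERIV_shift[of "bernoulli_poly (Suc n)" _ t 1] bernoulli_poly_has_derivative by blast
  from DERIV_cdivide[OF DERIV_add[OF bernoulli_poly_has_derivative this], where c = 2]
  show ?thesis
    unfolding reciprocal_bernoulli_poly_def [abs_def]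
    by (rule DERIV_cong) (simp add: field_simps)
qed

lemma reciprocal_bernoulli_poly_1: "reciprocal_bernoulli_poly (Suc 0) t = t"
proof -
  let ?g = "bernoulli_gf t"
  have "(?g * (fps_exp 1 - 1)) $ i = (fps_X * fps_exp t) $ i" for i
    by (simp add: bernoulli_gf_mult)
  from this[of 1] this[of 2] have "?g $ 0 = 1" "?g $ 1 = t - 1 / 2"
    by (simp_all add: fps_mult_nth numeral_2_eq_2)
  thus ?thesis
    by (simp add: reciprocal_bernoulli_poly_altdef bernoulli_poly_def)
qed

text \<open>
  The reciprocal Bernoulli polynomials are even or odd about \<open>0\<close>, whereas \<open>B\<^sub>n\<close> has its symmetry about
  \<open>1/2\<close>; this is what the averaging over \<open>t\<close> and \<open>t + 1\<close> achieves.  The generating function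
  \<open>z e\<^sup>t\<^sup>z (e\<^sup>z + 1) / (e\<^sup>z - 1)\<close> of \<open>2 \<cdot> reciprocal_bernoulli_poly n t / n!\<close> does not change under
  \<open>(t, z) \<mapsto> (-t, -z)\<close>.  In the table the cells \<open>K - k\<close> and \<open>n - k\<close> have shift \<open>-t\<close>, and the parity
  produces the sign \<open>(-1) ^ (m + 1)\<close> inside \<open>coeff_Xi\<close>.
\<close>

lemma reciprocal_bernoulli_poly_minus:
  "reciprocal_bernoulli_poly n (-t) = (-1) ^ n * reciprocal_bernoulli_poly n t"
proof -
  define G where "G = (\<lambda>s. bernoulli_gf s + bernoulli_gf (s + 1))"
  have G: "G s * (fps_exp 1 - 1) = fps_X * fps_exp s * (fps_exp 1 + 1)" for s
    by (simp add: G_def distrib_right distrib_left bernoulli_gf_mult fps_exp_add_mult mult.assoc)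
  \<comment> \<open>substitute \<open>-z\<close> for \<open>z\<close> in the equation at \<open>-t\<close>, then clear \<open>e\<^sup>-\<^sup>z\<close>\<close>
  have "(G (-t) * (fps_exp 1 - 1)) oo (-fps_X) = (fps_X * fps_exp (-t) * (fps_exp 1 + 1)) oo (-fps_X)"
    by (simp only: G)
  hence "(G (-t) oo (-fps_X)) * (fps_exp (-1) - 1) = -fps_X * fps_exp t * (fps_exp (-1) + 1)"
    by (simp add: fps_compose_mult_distrib fps_compose_add_distrib fps_compose_sub_distrib)
  hence "(G (-t) oo (-fps_X)) * (fps_exp (-1) - 1) * fps_exp 1
           = -fps_X * fps_exp t * (fps_exp (-1) + 1) * fps_exp 1" by simp
  moreover have "fps_exp (-1) * fps_exp 1 = (1 :: real fps)"
    by (simp flip: fps_exp_add_mult)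
  ultimately have "(G (-t) oo (-fps_X)) * (1 - fps_exp 1) = -fps_X * fps_exp t * (1 + fps_exp 1)"
    by (simp add: mult.assoc distrib_right left_diff_distrib)
  hence "(G (-t) oo (-fps_X)) * (fps_exp 1 - 1) = fps_X * fps_exp t * (fps_exp 1 + 1)"
    by (simp add: algebra_simps)
  hence "(G (-t) oo (-fps_X)) * (fps_exp 1 - 1) = G t * (fps_exp 1 - 1)"
    by (simp add: G)
  hence "G (-t) oo (-fps_X) = G t"
    using fps_exp_1_minus_1_nonzero by simp
  hence "(G (-t) oo (-fps_X)) $ n = G t $ n" by simp
  hence "(-1) ^ n * G (-t) $ n = G t $ n"
    by (simp add: fps_compose_uminus')
  hence "G (-t) $ n = (-1) ^ n * G t $ n"
    by (metis left_minus_one_mult_self)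
  thus ?thesis
    by (simp add: G_def reciprocal_bernoulli_poly_def bernoulli_poly_def flip: distrib_left)
qed

lemma continuous_on_reciprocal_bernoulli_poly: "continuous_on S (reciprocal_bernoulli_poly (Suc n))"
  using reciprocal_bernoulli_poly_has_derivative
  by (meson DERIV_isCont continuous_at_imp_continuous_on)

section \<open>The Stirling sum and its invariance under shifts\<close>

text \<open>
  The truncated asymptotic series in \<open>x\<close>, at fixed \<open>t\<close>, of
  \<open>(ln \<Gamma>(x + t) + ln \<Gamma>(x + t + 1)) / 2 - ln (2\<pi>) / 2\<close>.
\<close>

definition stirling_sum :: "nat \<Rightarrow> real \<Rightarrow> real \<Rightarrow> real" where
  "stirling_sum M x t = (x + t) * ln x - x +
     (\<Sum>m=1..M. (-1) ^ (m + 1) * reciprocal_bernoulli_poly (m + 1) t / (real m * (real m + 1) * x ^ m))"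

text \<open>
  A function of \<open>x + t\<close> alone is constant along the lines \<open>x + t = y\<close>.  The truncated series nearly is:
  each summand contributes one term from differentiating the power of \<open>u\<close> and one from
  \<open>(d/dt) reciprocal_bernoulli_poly (m + 1) t = (m + 1) \<cdot> reciprocal_bernoulli_poly m t\<close>.  These cancel between
  neighbouring values of \<open>m\<close>, the leading part contributes \<open>t/u\<close>, which cancels against the first
  summand since \<open>reciprocal_bernoulli_poly 1 t = t\<close>, and only the last term survives.
\<close>

lemma stirling_sum_antidiagonal_derivative:
  assumes "u > 0"
  shows "((\<lambda>u. stirling_sum M u (y - u)) has_field_derivative
           (-1) ^ M * reciprocal_bernoulli_poly (M + 1) (y - u) / ((real M + 1) * u ^ (M + 1))) (at u)"
proof (induction M)
  case 0
  show ?case unfolding stirling_sum_def using assms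
    by (auto intro!: derivative_eq_intros simp: reciprocal_bernoulli_poly_1 field_simps)
next
  case (Suc M)
  let ?B = "reciprocal_bernoulli_poly"
  have step: "stirling_sum (Suc M) u s = stirling_sum M u s +
      (-1) ^ M / ((real M + 1) * (real M + 2)) * (?B (Suc (Suc M)) s / u ^ Suc M)" for u s
    by (simp add: stirling_sum_def field_simps)
  have "((\<lambda>u. ?B (Suc (Suc M)) (y - u)) has_field_derivative
          (real (Suc (Suc M)) * ?B (Suc M) (y - u)) * (0 - 1)) (at u)"
    by (rule DERIV_chain2[OF reciprocal_bernoulli_poly_has_derivative])
       (auto intro!: derivative_eq_intros)
  moreover have "((\<lambda>u. u ^ Suc M) has_field_derivative (real M + 1) * u ^ M) (at u)"
    using DERIV_pow[of "Suc M" u] by (simp add: add.commute)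
  ultimately have "((\<lambda>u. ?B (Suc (Suc M)) (y - u) / u ^ Suc M) has_field_derivative
      ((real (Suc (Suc M)) * ?B (Suc M) (y - u)) * (0 - 1) * u ^ Suc M
        - ?B (Suc (Suc M)) (y - u) * ((real M + 1) * u ^ M)) / (u ^ Suc M * u ^ Suc M)) (at u)"
    by (rule DERIV_divide) (use assms in simp)
  from DERIV_add[OF Suc DERIV_cmult[OF this]]
  show ?case
    unfolding step by (rule DERIV_cong) (use assms in \<open>simp add: divide_simps, simp add: algebra_simps\<close>)
qed

text \<open>
  Consequently the expansion at \<open>(x, t)\<close> follows from the one at \<open>(x + t, 0)\<close>: the mean value theorem
  along the antidiagonal bounds their difference at the order of the first omitted term, uniformly
  for bounded \<open>t\<close>.  The requirement \<open>2 T \<le> x\<close> keeps the whole path in the region \<open>u \<ge> x/2\<close>.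
\<close>

lemma stirling_sum_shift:
  fixes T :: real
  assumes "T \<ge> 0"
  obtains C where "C \<ge> 0"
    and "\<And>x t. x > 0 \<Longrightarrow> 2 * T \<le> x \<Longrightarrow> \<bar>t\<bar> \<le> T \<Longrightarrow>
           \<bar>stirling_sum M (x + t) 0 - stirling_sum M x t\<bar> \<le> C / x ^ (M + 1)"
proof -
  let ?B = "reciprocal_bernoulli_poly"
  have "bounded (?B (Suc M) ` {-T..T})"
    by (intro compact_imp_bounded compact_continuous_image continuous_on_reciprocal_bernoulli_poly) simp
  then obtain b where b: "b > 0" "\<And>s. \<bar>s\<bar> \<le> T \<Longrightarrow> \<bar>?B (Suc M) s\<bar> \<le> b"
    by (auto simp: bounded_pos abs_le_iff)
  show thesis
  proof
    show "2 ^ (M + 1) * b * T \<ge> 0" using b assms by simp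
  next
    fix x t :: real
    assume x: "x > 0" "2 * T \<le> x" and t: "\<bar>t\<bar> \<le> T"
    let ?f = "\<lambda>u. stirling_sum M u (x + t - u)"
    let ?f' = "\<lambda>u. (-1) ^ M * ?B (M + 1) (x + t - u) / ((real M + 1) * u ^ (M + 1))"
    let ?S = "{min x (x + t)..max x (x + t)}"
    have S: "u \<ge> x / 2" "\<bar>x + t - u\<bar> \<le> T" if "u \<in> ?S" for u
      using that x t by auto
    have "norm (?f (x + t) - ?f x) \<le> (b / (x / 2) ^ (M + 1)) * norm (x + t - x)"
    proof (rule field_differentiable_bound[of ?S _ ?f'])
      fix u assume u: "u \<in> ?S"
      from S(1)[OF u] x have "u > 0" by simp
      then show "(?f has_field_derivative ?f' u) (at u within ?S)"
        using stirling_sum_antidiagonal_derivative has_field_derivative_at_within by blast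
      have "\<bar>?B (M + 1) (x + t - u)\<bar> / ((real M + 1) * u ^ (M + 1)) \<le> b / (1 * (x / 2) ^ (M + 1))"
        using b S[OF u] x \<open>u > 0\<close> by (intro frac_le mult_mono power_mono) auto
      thus "norm (?f' u) \<le> b / (x / 2) ^ (M + 1)"
        using \<open>u > 0\<close> by (simp add: abs_mult power_abs)
    qed auto
    also have "\<dots> = 2 ^ (M + 1) * b * \<bar>t\<bar> / x ^ (M + 1)"
      using x by (simp add: field_simps)
    also have "\<dots> \<le> 2 ^ (M + 1) * b * T / x ^ (M + 1)"
      using b x t by (intro divide_right_mono mult_left_mono) auto
    finally show "\<bar>stirling_sum M (x + t) 0 - stirling_sum M x t\<bar> \<le> 2 ^ (M + 1) * b * T / x ^ (M + 1)"
      by simp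
  qed
qed

section \<open>Stirling's expansion of the factorial with remainder\<close>

text \<open>
  The derivative of the remainder is \<open>(-u) ^ M / (1 + u)\<close>, by the geometric sum.
\<close>

lemma ln_1_plus_taylor_bound:
  fixes z :: real
  assumes "z \<ge> 0"
  shows "\<bar>ln (1 + z) - (\<Sum>m=1..M. (-1) ^ (m + 1) * z ^ m / real m)\<bar> \<le> z ^ (M + 1)"
proof -
  let ?f = "\<lambda>z. ln (1 + z) - (\<Sum>m=1..M. (-1) ^ (m + 1) * z ^ m / real m)"
  have deriv: "(?f has_field_derivative (-u) ^ M / (1 + u)) (at u)" if "u \<ge> 0" for u :: real
  proof (induction M)
    case 0
    show ?case using that by (auto intro!: derivative_eq_intros)
  next
    case (Suc M)
    have "((\<lambda>z. (-1) ^ (Suc M + 1) * z ^ Suc M / real (Suc M)) has_field_derivative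
             (-1) ^ (Suc M + 1) * (real (Suc M) * u ^ M) / real (Suc M)) (at u)"
      using DERIV_pow[of "Suc M" u] by (intro DERIV_cdivide DERIV_cmult) simp
    from DERIV_diff[OF Suc this]
    have "((\<lambda>z. ln (1 + z) - (\<Sum>m=1..Suc M. (-1) ^ (m + 1) * z ^ m / real m)) has_field_derivative
            (-u) ^ M / (1 + u) - (-1) ^ (Suc M + 1) * (real (Suc M) * u ^ M) / real (Suc M)) (at u)"
      by (simp add: algebra_simps)
    moreover have "(-1) ^ (Suc M + 1) * (real (Suc M) * u ^ M) / real (Suc M) = (-u) ^ M"
      by (simp add: power_minus[of u] del: of_nat_Suc)
    moreover have "(-u) ^ M / (1 + u) - (-u) ^ M = (-u) ^ Suc M / (1 + u)"
      using that by (simp add: divide_simps) (simp add: algebra_simps)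
    ultimately show ?case by simp
  qed
  have "norm (?f z - ?f 0) \<le> z ^ M * norm (z - 0)"
  proof (rule field_differentiable_bound[of "{0..z}" _ "\<lambda>u. (-u) ^ M / (1 + u)"])
    fix u assume u: "u \<in> {0..z}"
    show "(?f has_field_derivative (-u) ^ M / (1 + u)) (at u within {0..z})"
      using deriv u has_field_derivative_at_within by (meson atLeastAtMost_iff)
    have "u ^ M / (1 + u) \<le> z ^ M / 1"
      using u by (intro frac_le power_mono) auto
    thus "norm ((-u) ^ M / (1 + u)) \<le> z ^ M"
      using u by (simp add: power_abs)
  qed (use assms in auto)
  moreover have "?f 0 = 0"
    by (simp add: sum.neutral)
  ultimately show ?thesis using assms by (simp add: mult.commute)
qed

text \<open>
  Removing half of \<open>ln n\<close> from \<open>ln n!\<close> leaves \<open>(ln \<Gamma>(n) + ln \<Gamma>(n + 1)) / 2\<close>, whose expansion has the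
  parity of the reciprocal Bernoulli polynomials.  The square root in \<open>log_normalized_mass\<close> supplies
  exactly these half logarithms.
\<close>

definition log_fact_core :: "nat \<Rightarrow> real" where
  "log_fact_core n = ln (fact n) - ln (real n) / 2 - ln (2 * pi) / 2"

lemma log_fact_core_Suc:
  assumes "n > 0"
  shows "log_fact_core (Suc n) - log_fact_core n = ln (real n) + ln (1 + 1 / real n) / 2"
proof -
  have "real (Suc n) = real n * (1 + 1 / real n)"
    using assms by (simp add: field_simps)
  hence "ln (real (Suc n)) = ln (real n * (1 + 1 / real n))"
    by (rule arg_cong)
  also have "\<dots> = ln (real n) + ln (1 + 1 / real n)"
    using assms by (subst ln_mult_pos) (auto simp: add_pos_pos)
  finally have l: "ln (real (Suc n)) = ln (real n) + ln (1 + 1 / real n)" .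
  have "ln (fact (Suc n) :: real) = ln (real (Suc n)) + ln (fact n)"
    unfolding fact_Suc by (subst ln_mult) auto
  thus ?thesis unfolding log_fact_core_def l by (simp add: field_simps)
qed

text \<open>
  Since \<open>reciprocal_bernoulli_poly (m + 1)\<close> increases by \<open>(m + 1) / 2\<close> from \<open>0\<close> to \<open>1\<close> when \<open>m \<ge> 1\<close>, the
  increment in \<open>t\<close> is the Taylor polynomial of \<open>ln x + ln (1 + 1/x) / 2\<close>, which is the increment of
  \<open>log_fact_core\<close>.
\<close>

lemma stirling_sum_at_one:
  "stirling_sum M x 1 - stirling_sum M x 0 =
     ln x + (\<Sum>m=1..M. (-1) ^ (m + 1) * (1 / x) ^ m / real m) / 2"
proof -
  have diff: "reciprocal_bernoulli_poly (m + 1) 1 - reciprocal_bernoulli_poly (m + 1) 0 = (real m + 1) / 2"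
    if "m \<ge> 1" for m
    using that bernoulli_poly_diff[of "m + 1" 0]
    by (simp add: reciprocal_bernoulli_poly_altdef power_0_left field_simps)
  have "(\<Sum>m=1..M. (-1) ^ (m + 1) * reciprocal_bernoulli_poly (m + 1) 1 / (real m * (real m + 1) * x ^ m))
      - (\<Sum>m=1..M. (-1) ^ (m + 1) * reciprocal_bernoulli_poly (m + 1) 0 / (real m * (real m + 1) * x ^ m))
      = (\<Sum>m=1..M. (-1) ^ (m + 1) * (1 / x) ^ m / real m / 2)"
    unfolding sum_subtractf [symmetric]
  proof (rule sum.cong)
    fix m assume "m \<in> {1..M}"
    hence m: "m \<ge> 1" by simp
    have "(-1) ^ (m + 1) * reciprocal_bernoulli_poly (m + 1) 1 / (real m * (real m + 1) * x ^ m)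
        - (-1) ^ (m + 1) * reciprocal_bernoulli_poly (m + 1) 0 / (real m * (real m + 1) * x ^ m)
        = (-1) ^ (m + 1) * ((real m + 1) / 2) / (real m * (real m + 1) * x ^ m)"
      unfolding diff[OF m, symmetric] by (simp only: right_diff_distrib diff_divide_distrib)
    also have "\<dots> = (-1) ^ (m + 1) * (1 / x) ^ m / real m / 2"
      using m by (simp add: power_one_over divide_simps)
    finally show "(-1) ^ (m + 1) * reciprocal_bernoulli_poly (m + 1) 1 / (real m * (real m + 1) * x ^ m)
        - (-1) ^ (m + 1) * reciprocal_bernoulli_poly (m + 1) 0 / (real m * (real m + 1) * x ^ m)
        = (-1) ^ (m + 1) * (1 / x) ^ m / real m / 2" .
  qed simp
  thus ?thesis
    unfolding stirling_sum_def by (simp add: algebra_simps sum_divide_distrib)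
qed

text \<open>
  One step from \<open>n\<close> to \<open>n + 1\<close> compares \<open>stirling_sum\<close> at \<open>(n + 1, 0)\<close>, \<open>(n, 1)\<close> and \<open>(n, 0)\<close>: the first
  two agree by shift invariance, and the last two differ by the Taylor polynomial of the true increment.
\<close>

lemma stirling_error_step:
  obtains C where "C \<ge> 0"
    and "\<And>n. n \<ge> 2 \<Longrightarrow>
           \<bar>(log_fact_core (Suc n) - stirling_sum M (real (Suc n)) 0)
            - (log_fact_core n - stirling_sum M (real n) 0)\<bar> \<le> C / real n ^ (M + 1)"
proof -
  obtain C where C: "C \<ge> 0"
    "\<And>x t. x > 0 \<Longrightarrow> 2 * 1 \<le> x \<Longrightarrow> \<bar>t\<bar> \<le> 1 \<Longrightarrow>
           \<bar>stirling_sum M (x + t) 0 - stirling_sum M x t\<bar> \<le> C / x ^ (M + 1)"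
    using stirling_sum_shift[of 1 M] by auto
  show thesis
  proof
    show "C + 1 \<ge> 0" using C by simp
  next
    fix n :: nat assume n: "n \<ge> 2"
    have "\<bar>stirling_sum M (real (Suc n)) 0 - stirling_sum M (real n) 1\<bar> \<le> C / real n ^ (M + 1)"
      using C(2)[of "real n" 1] n by (simp add: add.commute)
    moreover have "\<bar>ln (1 + 1 / real n) - (\<Sum>m=1..M. (-1) ^ (m + 1) * (1 / real n) ^ m / real m)\<bar>
        \<le> 1 / real n ^ (M + 1)"
      using ln_1_plus_taylor_bound[of "1 / real n" M] by (simp add: power_one_over)
    ultimately show "\<bar>(log_fact_core (Suc n) - stirling_sum M (real (Suc n)) 0)
            - (log_fact_core n - stirling_sum M (real n) 0)\<bar> \<le> (C + 1) / real n ^ (M + 1)"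
      unfolding add_divide_distrib
      using log_fact_core_Suc[of n] stirling_sum_at_one[of M "real n"] n by linarith
  qed
qed

text \<open>
  Summing increments of order \<open>n ^ -(p + 1)\<close> from \<open>n\<close> to infinity gives order \<open>n ^ -p\<close>.  The tail sum is
  avoided: with \<open>D = C \<cdot> 2 ^ (p + 1)\<close> the decrease of \<open>D / k ^ p\<close> dominates the increments, so
  \<open>\<plusminus> e k - D / k ^ p\<close> is increasing with limit \<open>0\<close>, hence nonpositive.
\<close>

lemma bound_from_null_increments:
  fixes e :: "nat \<Rightarrow> real"
  assumes lim: "e \<longlonglongrightarrow> 0"
    and step: "\<And>n. n \<ge> n0 \<Longrightarrow> \<bar>e (Suc n) - e n\<bar> \<le> C / real n ^ (p + 1)"
    and C: "C \<ge> 0" and p: "p > 0" and n0: "n0 > 0" and n: "n \<ge> n0"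
  shows "\<bar>e n\<bar> \<le> C * 2 ^ (p + 1) / real n ^ p"
proof -
  define D where "D = C * 2 ^ (p + 1)"
  \<comment> \<open>uses \<open>(k + 1) ^ p - k ^ p \<ge> k ^ (p - 1)\<close>, and \<open>k + 1 \<le> 2 k\<close> to pass between the powers\<close>
  have gain: "C / real k ^ (p + 1) \<le> D / real k ^ p - D / real (Suc k) ^ p" if "k \<ge> n0" for k
  proof -
    from that n0 have k: "k \<ge> 1" by simp
    have "real k ^ (p - 1) * real (Suc k) \<le> real (Suc k) ^ (p - 1) * real (Suc k)"
      by (intro mult_right_mono power_mono) auto
    hence "real k ^ p + real k ^ (p - 1) \<le> real (Suc k) ^ p"
      using p by (cases p) (auto simp: algebra_simps)
    have "1 / real k ^ p - 1 / real (Suc k) ^ p = (real (Suc k) ^ p - real k ^ p) / (real k ^ p * real (Suc k) ^ p)"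
      using k by (simp add: divide_simps)
    also have "\<dots> \<ge> real k ^ (p - 1) / (real k ^ p * real (Suc k) ^ p)"
      using \<open>real k ^ p + real k ^ (p - 1) \<le> real (Suc k) ^ p\<close> by (intro divide_right_mono) auto
    also have "real k ^ (p - 1) / (real k ^ p * real (Suc k) ^ p) = 1 / (real k * real (Suc k) ^ p)"
      using k p by (cases p) auto
    finally have 1: "1 / (real k * real (Suc k) ^ p) \<le> 1 / real k ^ p - 1 / real (Suc k) ^ p" .
    have "1 / real k ^ (p + 1) = 2 ^ p / (real k * (2 * real k) ^ p)"
      using k by (simp add: field_simps)
    also have "\<dots> \<le> 2 ^ p / (real k * real (Suc k) ^ p)"
      using k by (intro divide_left_mono mult_left_mono power_mono mult_pos_pos) auto
    also have "\<dots> \<le> 2 ^ (p + 1) * (1 / (real k * real (Suc k) ^ p))"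
      using k by (simp add: divide_right_mono)
    also have "\<dots> \<le> 2 ^ (p + 1) * (1 / real k ^ p - 1 / real (Suc k) ^ p)"
      by (intro mult_left_mono 1) auto
    finally have "C * (1 / real k ^ (p + 1)) \<le> C * (2 ^ (p + 1) * (1 / real k ^ p - 1 / real (Suc k) ^ p))"
      by (rule mult_left_mono[OF _ C])
    thus ?thesis by (simp add: D_def algebra_simps)
  qed
  have Dlim: "(\<lambda>k. D / real k ^ p) \<longlonglongrightarrow> 0"
    by (intro tendsto_divide_0[OF tendsto_const] filterlim_at_top_imp_at_infinity
          filterlim_pow_at_top filterlim_real_sequentially p)
  have one_sided: "f n \<le> D / real n ^ p"
    if f: "f \<longlonglongrightarrow> 0" "\<And>k. k \<ge> n0 \<Longrightarrow> f k - f (Suc k) \<le> C / real k ^ (p + 1)" for f :: "nat \<Rightarrow> real"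
  proof -
    define u where "u k = f (k + n) - D / real (k + n) ^ p" for k
    have "incseq u"
    proof (rule incseq_SucI)
      fix k
      show "u k \<le> u (Suc k)"
        using gain[of "k + n"] f(2)[of "k + n"] n by (simp add: u_def)
    qed
    moreover have "u \<longlonglongrightarrow> 0 - 0"
      unfolding u_def by (intro tendsto_diff LIMSEQ_ignore_initial_segment f(1) Dlim)
    ultimately have "u 0 \<le> 0"
      using incseq_le by fastforce
    thus ?thesis by (simp add: u_def)
  qed
  have "e n \<le> D / real n ^ p"
    by (rule one_sided) (use lim step in \<open>force simp: abs_le_iff\<close>)+
  moreover have "-e n \<le> D / real n ^ p"
    by (rule one_sided[of "\<lambda>k. -e k"])
       (use step tendsto_minus[OF lim] in \<open>force simp: abs_le_iff\<close>)+
  ultimately show ?thesis by (simp add: D_def abs_le_iff)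
qed

lemma wallis_partial_product:
  "(\<Prod>k=1..n. (4 * real k ^ 2) / (4 * real k ^ 2 - 1)) =
     2 ^ (4 * n) * fact n ^ 4 / (fact (2 * n) ^ 2 * (2 * real n + 1))"
proof (induction n)
  case (Suc n)
  define a b c where "a = real n + 1" and "b = 2 * real n + 1" and "c = 2 * real n + 3"
  have nz: "a \<noteq> 0" "b \<noteq> 0" "c \<noteq> 0" unfolding a_def b_def c_def by linarith+
  have f: "fact (2 * Suc n) = 2 * a * (b * fact (2 * n))" "fact (Suc n) = a * fact n"
    by (simp_all add: a_def b_def algebra_simps)
  have abc: "4 * a ^ 2 - 1 = b * c" "real (Suc n) = a" "2 * a + 1 = c"
    by (simp_all add: a_def b_def c_def power2_eq_square algebra_simps)
  have step: "E * f ^ 4 / (F ^ 2 * b) * (4 * a ^ 2 / (b * c)) =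
          16 * E * (a * f) ^ 4 / ((2 * a * (b * F)) ^ 2 * c)" if "F \<noteq> 0" for E f F :: real
    using nz that by (simp add: divide_simps) (simp add: eval_nat_numeral algebra_simps)
  have "(\<Prod>k=1..Suc n. (4 * real k ^ 2) / (4 * real k ^ 2 - 1)) =
          (\<Prod>k=1..n. (4 * real k ^ 2) / (4 * real k ^ 2 - 1)) *
          (4 * real (Suc n) ^ 2 / (4 * real (Suc n) ^ 2 - 1))"
    by simp
  also have "\<dots> = 2 ^ (4 * n) * fact n ^ 4 / (fact (2 * n) ^ 2 * b) * (4 * a ^ 2 / (b * c))"
    unfolding Suc abc(2) abc(1) by (simp only: b_def)
  also have "\<dots> = 16 * 2 ^ (4 * n) * (a * fact n) ^ 4 / ((2 * a * (b * fact (2 * n))) ^ 2 * c)"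
    by (rule step) simp
  also have "\<dots> = 2 ^ (4 * Suc n) * fact (Suc n) ^ 4 / (fact (2 * Suc n) ^ 2 * (2 * real (Suc n) + 1))"
    unfolding f abc by (simp add: power_add)
  finally show ?case .
qed auto

text \<open>
  The increments of the first-order remainder are summable, so a limit \<open>l\<close> exists.  The logarithm of
  the Wallis product is, up to explicit terms, \<open>4 r(n) - 2 r(2 n)\<close>, which tends to \<open>2 l\<close>, and comparison
  with \<open>ln (\<pi>/2)\<close> gives \<open>l = 0\<close>.  This fixes the constant \<open>ln (2\<pi>) / 2\<close>.
\<close>

lemma stirling_remainder_tendsto_0:
  "(\<lambda>n. log_fact_core n - stirling_sum 0 (real n) 0) \<longlonglongrightarrow> 0"
proof -
  \<comment> \<open>the increments of \<open>r\<close> are only \<open>O(1/n)\<close> by the step estimate, so one more term is subtracted first\<close>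
  define r where "r n = log_fact_core n - stirling_sum 0 (real n) 0" for n
  define e where "e n = log_fact_core n - stirling_sum 1 (real n) 0" for n
  obtain C where C: "C \<ge> 0" "\<And>n. n \<ge> 2 \<Longrightarrow> \<bar>e (Suc n) - e n\<bar> \<le> C / real n ^ (1 + 1)"
    using stirling_error_step[of 1] unfolding e_def by metis
  have "summable (\<lambda>n. e (Suc n) - e n)"
  proof (rule summable_comparison_test')
    show "summable (\<lambda>n. C * inverse (real n ^ 2))"
      by (intro summable_mult inverse_power_summable) simp
    show "norm (e (Suc n) - e n) \<le> C * inverse (real n ^ 2)" if "n \<ge> 2" for n
      using C(2)[OF that] by (simp add: divide_inverse numeral_2_eq_2)
  qed
  from summable_LIMSEQ[OF this]
  have "(\<lambda>n. e n - e 0) \<longlonglongrightarrow> (\<Sum>n. e (Suc n) - e n)"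
    by (simp add: sum_lessThan_telescope)
  from tendsto_add[OF this tendsto_const[of "e 0"]]
  have "e \<longlonglongrightarrow> (\<Sum>n. e (Suc n) - e n) + e 0" by simp
  moreover have "(\<lambda>n. reciprocal_bernoulli_poly 2 0 / 2 / real n) \<longlonglongrightarrow> 0"
    by (rule lim_const_over_n)
  ultimately have "(\<lambda>n. e n + reciprocal_bernoulli_poly 2 0 / 2 / real n) \<longlonglongrightarrow> (\<Sum>n. e (Suc n) - e n) + e 0 + 0"
    by (rule tendsto_add)
  also have "(\<lambda>n. e n + reciprocal_bernoulli_poly 2 0 / 2 / real n) = r"
    by (auto simp: e_def r_def stirling_sum_def numeral_2_eq_2)
  finally obtain l where l: "r \<longlonglongrightarrow> l" by blast
  define w where "w n = 4 * r n - 2 * r (2 * n) + ln (2 * pi) - ln 2 - ln (2 + 1 / real n)" for n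
  have wallis_eq: "ln (\<Prod>k=1..n. (4 * real k ^ 2) / (4 * real k ^ 2 - 1)) = w n" if n: "n > 0" for n
  proof -
    have "ln (2 + 1 / real n) = ln ((2 * real n + 1) / real n)"
      using n by (simp add: field_simps)
    also have "\<dots> = ln (2 * real n + 1) - ln (real n)"
      using n by (subst ln_div) auto
    finally have 1: "ln (2 * real n + 1) = ln (2 + 1 / real n) + ln (real n)" by simp
    have r_eq: "ln (fact m) = r m + (real m + 1 / 2) * ln (real m) - real m + ln (2 * pi) / 2" for m
      by (simp add: r_def log_fact_core_def stirling_sum_def algebra_simps)
    have 2: "ln (real (2 * n)) = ln 2 + ln (real n)"
      using n by (simp add: ln_mult)
    have "ln (2 ^ (4 * n) * fact n ^ 4 / (fact (2 * n) ^ 2 * (2 * real n + 1))) =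
            real (4 * n) * ln 2 + 4 * ln (fact n) - (2 * ln (fact (2 * n)) + ln (2 * real n + 1))"
      using n by (simp add: ln_div ln_mult ln_realpow add_pos_pos)
    also have "\<dots> = w n"
      unfolding r_eq 1 2 w_def using n by (simp add: algebra_simps)
    finally show ?thesis by (simp only: wallis_partial_product)
  qed
  have "(\<lambda>n. ln (\<Prod>k=1..n. (4 * real k ^ 2) / (4 * real k ^ 2 - 1))) \<longlonglongrightarrow> ln (pi / 2)"
    by (intro tendsto_ln wallis) simp
  moreover have "eventually (\<lambda>n. ln (\<Prod>k=1..n. (4 * real k ^ 2) / (4 * real k ^ 2 - 1)) = w n) sequentially"
    using eventually_gt_at_top[of 0] by eventually_elim (rule wallis_eq)
  ultimately have "w \<longlonglongrightarrow> ln (pi / 2)"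
    by (rule Lim_transform_eventually)
  moreover have "w \<longlonglongrightarrow> 4 * l - 2 * l + ln (2 * pi) - ln 2 - ln (2 + 0)"
    unfolding w_def
    by (intro tendsto_intros l lim_const_over_n filterlim_compose[OF l] filterlim_subseq)
       (auto simp: strict_mono_def)
  ultimately have "ln (pi / 2) = 4 * l - 2 * l + ln (2 * pi) - ln 2 - ln (2 + 0)"
    by (rule LIMSEQ_unique)
  hence "l = 0" by (simp add: ln_div ln_mult)
  with l show ?thesis by (simp add: r_def [abs_def])
qed

text \<open>
  Summation of the increments loses one power of \<open>n\<close>.  It is recovered by working with \<open>M + 1\<close> terms
  and absorbing the last one into the error.
\<close>

lemma log_fact_core_expansion:
  obtains C where "C \<ge> 0"
    and "\<And>n. n \<ge> 2 \<Longrightarrow> \<bar>log_fact_core n - stirling_sum M (real n) 0\<bar> \<le> C / real n ^ (M + 1)"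
proof -
  let ?c = "\<lambda>m. (-1) ^ (m + 1) * reciprocal_bernoulli_poly (m + 1) 0 / (real m * (real m + 1))"
  define e where "e n = log_fact_core n - stirling_sum (M + 1) (real n) 0" for n
  obtain C where C: "C \<ge> 0" "\<And>n. n \<ge> 2 \<Longrightarrow> \<bar>e (Suc n) - e n\<bar> \<le> C / real n ^ ((M + 1) + 1)"
    using stirling_error_step[of "M + 1"] unfolding e_def by metis
  have "(\<lambda>n. log_fact_core n - stirling_sum 0 (real n) 0 - (\<Sum>m=1..M+1. ?c m / real n ^ m)) \<longlonglongrightarrow> 0 - (\<Sum>m=1..M+1. 0)"
  proof (intro tendsto_diff tendsto_sum stirling_remainder_tendsto_0)
    fix m assume "m \<in> {1..M+1}"
    thus "(\<lambda>n. ?c m / real n ^ m) \<longlonglongrightarrow> 0"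
      by (intro tendsto_divide_0[OF tendsto_const] filterlim_at_top_imp_at_infinity
            filterlim_pow_at_top filterlim_real_sequentially) auto
  qed
  hence "e \<longlonglongrightarrow> 0"
    by (simp add: e_def [abs_def] stirling_sum_def diff_diff_eq)
  note e_bound = bound_from_null_increments[OF this C(2) C(1)]
  show thesis
  proof
    show "C * 2 ^ (M + 1 + 1) + \<bar>?c (M + 1)\<bar> \<ge> 0" using C by simp
  next
    fix n :: nat assume n: "n \<ge> 2"
    have "log_fact_core n - stirling_sum M (real n) 0 = e n + ?c (M + 1) / real n ^ (M + 1)"
      by (simp add: e_def stirling_sum_def)
    also have "\<bar>\<dots>\<bar> \<le> \<bar>e n\<bar> + \<bar>?c (M + 1) / real n ^ (M + 1)\<bar>"
      by (rule abs_triangle_ineq)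
    also have "\<dots> \<le> C * 2 ^ (M + 1 + 1) / real n ^ (M + 1) + \<bar>?c (M + 1)\<bar> / real n ^ (M + 1)"
      using e_bound[of 2 "n"] n by (intro add_mono) (auto simp: abs_mult)
    finally show "\<bar>log_fact_core n - stirling_sum M (real n) 0\<bar>
        \<le> (C * 2 ^ (M + 1 + 1) + \<bar>?c (M + 1)\<bar>) / real n ^ (M + 1)"
      by (simp only: add_divide_distrib)
  qed
qed

text \<open>
  The expansion about \<open>x\<close> at the nearby natural number \<open>y = x + t\<close> follows from the one about \<open>y\<close> itself by
  shift invariance; \<open>y \<ge> x/2 \<ge> 2\<close> converts the error in \<open>y\<close> into one in \<open>x\<close>.
\<close>

lemma log_fact_core_shifted_expansion:
  fixes T :: real
  assumes "T \<ge> 0"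
  obtains C where "C \<ge> 0"
    and "\<And>x t y. x \<ge> 4 \<Longrightarrow> 2 * T \<le> x \<Longrightarrow> \<bar>t\<bar> \<le> T \<Longrightarrow> real y = x + t \<Longrightarrow>
           \<bar>log_fact_core y - stirling_sum M x t\<bar> \<le> C / x ^ (M + 1)"
proof -
  obtain C1 where C1: "C1 \<ge> 0"
    "\<And>x t. x > 0 \<Longrightarrow> 2 * T \<le> x \<Longrightarrow> \<bar>t\<bar> \<le> T \<Longrightarrow>
       \<bar>stirling_sum M (x + t) 0 - stirling_sum M x t\<bar> \<le> C1 / x ^ (M + 1)"
    using stirling_sum_shift[OF assms] by metis
  obtain C2 where C2: "C2 \<ge> 0"
    "\<And>n. n \<ge> 2 \<Longrightarrow> \<bar>log_fact_core n - stirling_sum M (real n) 0\<bar> \<le> C2 / real n ^ (M + 1)"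
    using log_fact_core_expansion by metis
  show thesis
  proof
    show "C2 * 2 ^ (M + 1) + C1 \<ge> 0" using C1 C2 by simp
  next
    fix x t :: real and y :: nat
    assume x: "x \<ge> 4" "2 * T \<le> x" and t: "\<bar>t\<bar> \<le> T" and y: "real y = x + t"
    have half: "real y \<ge> x / 2" using x t y by auto
    with x have "y \<ge> 2" by linarith
    hence "\<bar>log_fact_core y - stirling_sum M (x + t) 0\<bar> \<le> C2 / real y ^ (M + 1)"
      using C2(2)[of y] y by simp
    also have "\<dots> \<le> C2 / (x / 2) ^ (M + 1)"
      using half x C2 by (intro divide_left_mono power_mono) auto
    also have "\<dots> = C2 * 2 ^ (M + 1) / x ^ (M + 1)"
      by (simp add: power_divide)
    finally show "\<bar>log_fact_core y - stirling_sum M x t\<bar> \<le> (C2 * 2 ^ (M + 1) + C1) / x ^ (M + 1)"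
      using C1(2)[of x t] x t by (simp add: add_divide_distrib)
  qed
qed

section \<open>The hypergeometric law as a two-by-two table\<close>

lemma reciprocal_bernoulli_poly_at_0:
  "m \<ge> 1 \<Longrightarrow> reciprocal_bernoulli_poly (m + 1) 0 = bernoulli_number (m + 1)"
  by (simp add: reciprocal_bernoulli_poly_altdef bernoulli_number_def power_0_left)

text \<open>
  With cells \<open>k\<close>, \<open>i = K - k\<close>, \<open>j = n - k\<close>, \<open>l = L + k\<close> the mass is the product of the four marginal
  factorials over those of the cells and of the total.  Under the square root there are four cells
  and the total against four margins, so the half logarithms attach to the factorials with the
  required signs; the constants \<open>ln (2\<pi>) / 2\<close> of nine terms add up to the remaining factor \<open>2\<pi>\<close>.
\<close>

lemma log_normalized_mass_eq_log_fact_core: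
  assumes pos: "k > 0" "i > 0" "j > 0" "l > 0"
    and margins: "K = k + i" "n = k + j" "N = k + i + j + l"
  shows "log_normalized_mass N K n (int k) =
           log_fact_core K + log_fact_core (N - K) + log_fact_core n + log_fact_core (N - n) - log_fact_core N
           - log_fact_core k - log_fact_core i - log_fact_core j - log_fact_core l"
proof -
  have NK: "N - K = j + l" "N - n = i + l" using margins by auto
  have mass: "hypergeometric_mass N K n (int k) =
          (fact K * fact (N - K) * fact n * fact (N - n)) / (fact N * fact k * fact i * fact j * fact l)"
    using margins
    by (simp add: hypergeometric_mass_def binomial_fact NK nat_diff_distrib add_ac mult_ac)
  let ?X = "2 * pi * (real k * real i * real j * real l * real N)
              / (real K * real (N - K) * real n * real (N - n))"
  have "log_normalized_mass N K n (int k) = ln (sqrt ?X * hypergeometric_mass N K n (int k))"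
    unfolding log_normalized_mass_def Let_def using margins by (simp add: add_ac)
  also have "\<dots> = ln ?X / 2 + ln (hypergeometric_mass N K n (int k))"
    using pos margins unfolding mass by (subst ln_mult_pos) (auto simp: ln_sqrt)
  also have "ln ?X = ln (2 * pi) + ln (real k) + ln (real i) + ln (real j) + ln (real l) + ln (real N)
               - ln (real K) - ln (real (N - K)) - ln (real n) - ln (real (N - n))"
    using pos margins NK by (simp add: ln_mult_pos ln_divide_pos del: of_nat_add)
  also have "ln (hypergeometric_mass N K n (int k)) =
      ln (fact K) + ln (fact (N - K)) + ln (fact n) + ln (fact (N - n))
      - ln (fact N) - ln (fact k) - ln (fact i) - ln (fact j) - ln (fact l)"
    unfolding mass by (simp add: ln_mult_pos ln_divide_pos)
  finally show ?thesis unfolding log_fact_core_def by (simp add: field_simps)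
qed

text \<open>
  The nine Stirling sums add up exactly to the asserted partial sum.  In the elementary part, the
  cell proportions factor into margins, so the entropies cancel, and the terms linear in \<open>t\<close> carry
  \<open>ln (a d / (b c)) = 0\<close>.  The terms of order \<open>m\<close> give \<open>coeff_W - 1\<close> from the margins and the total
  (shift \<open>0\<close>) and \<open>coeff_Xi\<close> from the cells (shifts \<open>t\<close> and, by parity, \<open>-t\<close>).
\<close>

lemma stirling_sum_combination:
  fixes \<kappa> \<eta> x t :: real
  assumes \<kappa>: "0 < \<kappa>" "\<kappa> < 1" and \<eta>: "0 < \<eta>" "\<eta> < 1" and x: "x > 0"
  shows "stirling_sum M (\<kappa> * x) 0 + stirling_sum M ((1 - \<kappa>) * x) 0
       + stirling_sum M (\<eta> * x) 0 + stirling_sum M ((1 - \<eta>) * x) 0 - stirling_sum M x 0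
       - stirling_sum M (\<kappa> * \<eta> * x) t - stirling_sum M (\<kappa> * (1 - \<eta>) * x) (-t)
       - stirling_sum M (\<eta> * (1 - \<kappa>) * x) (-t) - stirling_sum M ((1 - \<kappa>) * (1 - \<eta>) * x) t
       = (\<Sum>m=1..M. coeff_A \<kappa> \<eta> m t / x ^ m)"
proof -
  let ?B = "reciprocal_bernoulli_poly"
  define b where "b y s m = (-1) ^ (m + 1) * ?B (m + 1) s / (real m * (real m + 1) * y ^ m)"
    for y s :: real and m :: nat
  define E where "E y s = (y + s) * ln y - y" for y s :: real
  have split: "stirling_sum M y s = E y s + (\<Sum>m=1..M. b y s m)" for y s
    by (simp add: stirling_sum_def b_def E_def)
  have elementary: "E (\<kappa> * x) 0 + E ((1 - \<kappa>) * x) 0 + E (\<eta> * x) 0 + E ((1 - \<eta>) * x) 0 - E x 0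
       - E (\<kappa> * \<eta> * x) t - E (\<kappa> * (1 - \<eta>) * x) (-t)
       - E (\<eta> * (1 - \<kappa>) * x) (-t) - E ((1 - \<kappa>) * (1 - \<eta>) * x) t = 0"
    unfolding E_def using assms
    by (simp add: ln_mult_pos) (simp add: algebra_simps)
  have coeff: "b (\<kappa> * x) 0 m + b ((1 - \<kappa>) * x) 0 m + b (\<eta> * x) 0 m + b ((1 - \<eta>) * x) 0 m - b x 0 m
       - b (\<kappa> * \<eta> * x) t m - b (\<kappa> * (1 - \<eta>) * x) (-t) m
       - b (\<eta> * (1 - \<kappa>) * x) (-t) m - b ((1 - \<kappa>) * (1 - \<eta>) * x) t m
       = coeff_A \<kappa> \<eta> m t / x ^ m" if "m \<in> {1..M}" for m
  proof -
    from that have m: "m \<ge> 1" by simp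
    define c where "c = (-1) ^ (m + 1) / (real m * (real m + 1))"
    have b_eq: "b (y * x) s m = c * ?B (m + 1) s * (1 / y ^ m) / x ^ m" for y s
      by (simp add: b_def c_def power_mult_distrib)
    have b1: "b x s m = c * ?B (m + 1) s / x ^ m" for s
      by (simp add: b_def c_def)
    define p q r s where "p = 1 / (\<kappa> * \<eta>) ^ m" and "q = 1 / (\<kappa> * (1 - \<eta>)) ^ m"
      and "r = 1 / (\<eta> * (1 - \<kappa>)) ^ m" and "s = 1 / ((1 - \<kappa>) * (1 - \<eta>)) ^ m"
    have Xi: "coeff_Xi \<kappa> \<eta> m = (p + s) + (-1) ^ (m + 1) * (q + r)"
      by (simp add: coeff_Xi_def Let_def p_def q_def r_def s_def)
    show ?thesis
      unfolding b_eq b1 reciprocal_bernoulli_poly_minus[of "m + 1"] reciprocal_bernoulli_poly_at_0[OF m]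
        coeff_A_def Xi c_def [symmetric] coeff_W_def p_def [symmetric] q_def [symmetric] r_def [symmetric]
        s_def [symmetric]
      by (simp only: flip: diff_divide_distrib add_divide_distrib times_divide_eq_right)
         (simp add: algebra_simps diff_divide_distrib add_divide_distrib)
  qed
  have "(\<Sum>m=1..M. coeff_A \<kappa> \<eta> m t / x ^ m) =
     (\<Sum>m=1..M. b (\<kappa> * x) 0 m + b ((1 - \<kappa>) * x) 0 m + b (\<eta> * x) 0 m + b ((1 - \<eta>) * x) 0 m - b x 0 m
       - b (\<kappa> * \<eta> * x) t m - b (\<kappa> * (1 - \<eta>) * x) (-t) m
       - b (\<eta> * (1 - \<kappa>) * x) (-t) m - b ((1 - \<kappa>) * (1 - \<eta>) * x) t m)"
    by (intro sum.cong refl coeff [symmetric])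
  thus ?thesis
    unfolding split sum.distrib sum_subtractf using elementary by linarith
qed

text \<open>
  Compactness of \<open>J\<close> makes all four cells grow at least like \<open>\<delta> N\<close>, and hence the error terms uniform.
\<close>

lemma cell_proportions_bounded_below:
  fixes J :: "(real \<times> real) set"
  assumes "compact J" "J \<subseteq> {0<..<1} \<times> {0<..<1}"
  obtains \<delta> where "\<delta> > 0"
    and "\<And>\<kappa> \<eta>. (\<kappa>, \<eta>) \<in> J \<Longrightarrow> \<delta> \<le> \<kappa> * \<eta> \<and> \<delta> \<le> \<kappa> * (1 - \<eta>) \<and> \<delta> \<le> \<eta> * (1 - \<kappa>) \<and> \<delta> \<le> (1 - \<kappa>) * (1 - \<eta>)"
proof (cases "J = {}")
  case True
  with that[of 1] show thesis by simp
next
  case False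
  define f :: "real \<times> real \<Rightarrow> real" where
    "f p = min (min (fst p * snd p) (fst p * (1 - snd p))) (min (snd p * (1 - fst p)) ((1 - fst p) * (1 - snd p)))" for p
  have "continuous_on J f"
    unfolding f_def by (intro continuous_intros)
  then obtain p where p: "p \<in> J" "\<And>q. q \<in> J \<Longrightarrow> f p \<le> f q"
    using continuous_attains_inf[OF assms(1) False] by blast
  from p(1) assms(2) have "f p > 0"
    by (auto simp: f_def)
  thus thesis
  proof (rule that)
    fix \<kappa> \<eta> assume "(\<kappa>, \<eta>) \<in> J"
    from p(2)[OF this] have "f p \<le> f (\<kappa>, \<eta>)" .
    thus "f p \<le> \<kappa> * \<eta> \<and> f p \<le> \<kappa> * (1 - \<eta>) \<and> f p \<le> \<eta> * (1 - \<kappa>) \<and> f p \<le> (1 - \<kappa>) * (1 - \<eta>)"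
      unfolding f_def[of "(\<kappa>, \<eta>)"] by simp
  qed
qed

theorem theorem5p2:
  fixes J :: "(real \<times> real) set" and H :: "real set"
  assumes "compact J" and "J \<subseteq> {0<..<1} \<times> {0<..<1}" and "compact H"
  shows "\<forall>M::nat. \<exists>(C::real) (N0::nat). \<forall>(N::nat) (K::nat) (n::nat) (k::int) (t::real).
           N \<ge> N0 \<and> 0 < K \<and> K < N \<and> 0 < n \<and> n < N
           \<and> (real K / real N, real n / real N) \<in> J
           \<and> t \<in> H \<and> real_of_int k = real n * real K / real N + t
           \<longrightarrow> 0 < k \<and> 0 < int K - k \<and> 0 < int n - k \<and> 0 < (int N - int K - int n) + k
             \<and> \<bar>log_normalized_mass N K n k
                - (\<Sum>m=1..M. coeff_A (real K / real N) (real n / real N) m t / real N ^ m)\<bar>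
               \<le> C / real N ^ (M + 1)"
proof
  fix M :: nat
  obtain \<delta> where \<delta>: "\<delta> > 0"
    "\<And>\<kappa> \<eta>. (\<kappa>, \<eta>) \<in> J \<Longrightarrow> \<delta> \<le> \<kappa> * \<eta> \<and> \<delta> \<le> \<kappa> * (1 - \<eta>) \<and> \<delta> \<le> \<eta> * (1 - \<kappa>) \<and> \<delta> \<le> (1 - \<kappa>) * (1 - \<eta>)"
    using cell_proportions_bounded_below[OF assms(1,2)] by blast
  from compact_imp_bounded[OF assms(3)] obtain T where T: "T > 0" "\<And>t. t \<in> H \<Longrightarrow> \<bar>t\<bar> \<le> T"
    by (auto simp: bounded_pos)
  obtain C where C: "C \<ge> 0" "\<And>x t y. x \<ge> 4 \<Longrightarrow> 2 * T \<le> x \<Longrightarrow> \<bar>t\<bar> \<le> T \<Longrightarrow> real y = x + t \<Longrightarrow>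
           \<bar>log_fact_core y - stirling_sum M x t\<bar> \<le> C / x ^ (M + 1)"
    using log_fact_core_shifted_expansion[of T M] T(1) by (metis less_imp_le)
  \<comment> \<open>for \<open>N \<ge> N0\<close> every leading part is at least \<open>max 4 (2 T)\<close>, so \<open>C\<close> applies, and the cells are positive\<close>
  obtain N0 :: nat where N0: "real N0 \<ge> (4 + 2 * T) / \<delta>"
    using real_arch_simple by blast
  show "\<exists>(C::real) (N0::nat). \<forall>(N::nat) (K::nat) (n::nat) (k::int) (t::real).
           N \<ge> N0 \<and> 0 < K \<and> K < N \<and> 0 < n \<and> n < N
           \<and> (real K / real N, real n / real N) \<in> J
           \<and> t \<in> H \<and> real_of_int k = real n * real K / real N + t
           \<longrightarrow> 0 < k \<and> 0 < int K - k \<and> 0 < int n - k \<and> 0 < (int N - int K - int n) + k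
             \<and> \<bar>log_normalized_mass N K n k
                - (\<Sum>m=1..M. coeff_A (real K / real N) (real n / real N) m t / real N ^ m)\<bar>
               \<le> C / real N ^ (M + 1)"
  \<comment> \<open>one error \<open>C / (\<delta> N) ^ (M + 1)\<close> for each of the nine terms\<close>
  proof (rule exI[of _ "9 * C / \<delta> ^ (M + 1)"], rule exI[of _ N0], intro allI impI)
    fix N K n :: nat and k :: int and t :: real
    assume "N \<ge> N0 \<and> 0 < K \<and> K < N \<and> 0 < n \<and> n < N
           \<and> (real K / real N, real n / real N) \<in> J
           \<and> t \<in> H \<and> real_of_int k = real n * real K / real N + t"
    hence N: "N \<ge> N0" and K: "0 < K" "K < N" and n: "0 < n" "n < N"
      and J: "(real K / real N, real n / real N) \<in> J"
      and t: "t \<in> H" and k: "real_of_int k = real n * real K / real N + t" by auto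
    define \<kappa> \<eta> where "\<kappa> = real K / real N" and "\<eta> = real n / real N"
    define x where "x = real N"
    have x: "x > 0" using K by (simp add: x_def)
    have K_eq: "real K = \<kappa> * x" and n_eq: "real n = \<eta> * x"
      using x by (simp_all add: \<kappa>_def \<eta>_def x_def)
    have \<kappa>: "0 < \<kappa>" "\<kappa> < 1" and \<eta>: "0 < \<eta>" "\<eta> < 1"
      using K n by (simp_all add: \<kappa>_def \<eta>_def)
    note \<delta>' = \<delta>(2)[OF J, folded \<kappa>_def \<eta>_def]
    have "(4 + 2 * T) / \<delta> \<le> x" using N0 N by (simp add: x_def)
    hence large: "4 + 2 * T \<le> \<delta> * x" using \<delta>(1) by (simp add: divide_simps mult.commute)
    have t': "\<bar>t\<bar> \<le> T" "\<bar>-t\<bar> \<le> T" "\<bar>0\<bar> \<le> T" using T t by auto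
    have cells: "real_of_int k = \<kappa> * \<eta> * x + t" "real_of_int (int K - k) = \<kappa> * (1 - \<eta>) * x + - t"
      "real_of_int (int n - k) = \<eta> * (1 - \<kappa>) * x + - t"
      "real_of_int ((int N - int K - int n) + k) = (1 - \<kappa>) * (1 - \<eta>) * x + t"
      using k x K_eq n_eq by (simp_all add: x_def [symmetric] algebra_simps)
    have cell_pos: "0 < y" if "real_of_int y = p * x + s" "\<delta> \<le> p" "\<bar>s\<bar> \<le> T" for y :: int and p s
    proof -
      have "\<delta> * x \<le> p * x" using that(2) x by simp
      with that large T(1) have "real_of_int y > 0" by linarith
      thus ?thesis by simp
    qed
    have pos: "0 < k" "0 < int K - k" "0 < int n - k" "0 < (int N - int K - int n) + k"
      using \<delta>' t' by (blast intro: cell_pos cells)+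
    define k' i j l where "k' = nat k" and "i = nat (int K - k)" and "j = nat (int n - k)"
      and "l = nat ((int N - int K - int n) + k)"
    have int_eq: "k = int k'" "int K - k = int i" "int n - k = int j" "(int N - int K - int n) + k = int l"
      using pos by (simp_all add: k'_def i_def j_def l_def)
    have mass: "log_normalized_mass N K n k =
           log_fact_core K + log_fact_core (N - K) + log_fact_core n + log_fact_core (N - n) - log_fact_core N
           - log_fact_core k' - log_fact_core i - log_fact_core j - log_fact_core l"
      unfolding int_eq(1) by (rule log_normalized_mass_eq_log_fact_core) (use int_eq pos in linarith)+
    define Q where "Q = C / (\<delta> * x) ^ (M + 1)"
    have approx: "\<bar>log_fact_core y - stirling_sum M (p * x) s\<bar> \<le> Q"
      if "real y = p * x + s" "\<delta> \<le> p" "\<bar>s\<bar> \<le> T" for y p s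
    proof -
      have px: "\<delta> * x \<le> p * x" using that(2) x by simp
      hence "\<bar>log_fact_core y - stirling_sum M (p * x) s\<bar> \<le> C / (p * x) ^ (M + 1)"
        using that large T(1) by (intro C(2)) auto
      also have "\<dots> \<le> Q"
        unfolding Q_def using px C(1) x \<delta>(1) by (intro divide_left_mono power_mono mult_pos_pos zero_less_power) auto
      finally show ?thesis .
    qed
    have "\<kappa> * \<eta> \<le> \<kappa>" "\<kappa> * \<eta> \<le> \<eta>" "(1 - \<kappa>) * (1 - \<eta>) \<le> 1 - \<kappa>" "(1 - \<kappa>) * (1 - \<eta>) \<le> 1 - \<eta>"
      using \<kappa> \<eta> by (simp_all add: mult_left_le mult_left_le_one_le)
    hence margins: "\<delta> \<le> \<kappa>" "\<delta> \<le> \<eta>" "\<delta> \<le> 1 - \<kappa>" "\<delta> \<le> 1 - \<eta>"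
      using \<delta>' by (meson order_trans)+
    with \<kappa> have "\<delta> \<le> 1" by linarith
    note margins = margins this
    have real_cells: "real k' = \<kappa> * \<eta> * x + t" "real i = \<kappa> * (1 - \<eta>) * x + - t"
      "real j = \<eta> * (1 - \<kappa>) * x + - t" "real l = (1 - \<kappa>) * (1 - \<eta>) * x + t"
      using cells unfolding int_eq(2-4) unfolding int_eq(1) by simp_all
    \<comment> \<open>the factor \<open>1\<close> in the last line lets \<open>approx\<close> apply with proportion \<open>p = 1\<close>\<close>
    have "\<bar>log_fact_core K - stirling_sum M (\<kappa> * x) 0\<bar> \<le> Q"
         "\<bar>log_fact_core (N - K) - stirling_sum M ((1 - \<kappa>) * x) 0\<bar> \<le> Q"
         "\<bar>log_fact_core n - stirling_sum M (\<eta> * x) 0\<bar> \<le> Q"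
         "\<bar>log_fact_core (N - n) - stirling_sum M ((1 - \<eta>) * x) 0\<bar> \<le> Q"
         "\<bar>log_fact_core N - stirling_sum M (1 * x) 0\<bar> \<le> Q"
      using K n K_eq n_eq T(1) margins
      by (intro approx; simp add: x_def [symmetric] of_nat_diff algebra_simps)+
    moreover have "\<bar>log_fact_core k' - stirling_sum M (\<kappa> * \<eta> * x) t\<bar> \<le> Q"
         "\<bar>log_fact_core i - stirling_sum M (\<kappa> * (1 - \<eta>) * x) (-t)\<bar> \<le> Q"
         "\<bar>log_fact_core j - stirling_sum M (\<eta> * (1 - \<kappa>) * x) (-t)\<bar> \<le> Q"
         "\<bar>log_fact_core l - stirling_sum M ((1 - \<kappa>) * (1 - \<eta>) * x) t\<bar> \<le> Q"
      using \<delta>' by (blast intro: approx real_cells t')+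
    ultimately have "\<bar>log_normalized_mass N K n k - (\<Sum>m=1..M. coeff_A \<kappa> \<eta> m t / x ^ m)\<bar> \<le> 9 * Q"
      unfolding mass stirling_sum_combination[OF \<kappa> \<eta> x, of M t, symmetric] mult_1 abs_le_iff
      by safe linarith+
    also have "9 * Q = 9 * C / \<delta> ^ (M + 1) / x ^ (M + 1)"
      by (simp add: Q_def power_mult_distrib)
    finally show "0 < k \<and> 0 < int K - k \<and> 0 < int n - k \<and> 0 < (int N - int K - int n) + k
             \<and> \<bar>log_normalized_mass N K n k
                - (\<Sum>m=1..M. coeff_A (real K / real N) (real n / real N) m t / real N ^ m)\<bar>
               \<le> 9 * C / \<delta> ^ (M + 1) / real N ^ (M + 1)"
      using pos unfolding \<kappa>_def \<eta>_def x_def by blast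
  qed
qed

end
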